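(* (1) For any integer $m \ge 1$, if $A, B, C$ are independent random variables each uniformly distributed on the set $\{1, 2, 4, \dots, 2^{m-1}\}$, then $$\mathbb{P}\left[A < \frac{B+C}{2}\right] = \frac{2}{3} - \frac{1}{2m} - \frac{1}{6m^2}.$$ (2) For all independent and identically distributed non-negative real random variables $A, B, C$, $$\mathbb{P}\left[A < \frac{B+C}{2}\right] \le \frac{2}{3},$$ and this inequality is strict if $A$ has at least one atom, i.e. if $\mathbb{P}[A = a] > 0$ for some $a \in \mathbb{R}_+ = [0,\infty)$. *)

theory Defs
  imports "HOL-Probability.Probability"
begin

text \<open>The law of \<open>X\<close> is compared on the Borel sets, so \<open>S\<close> is meant to be finite and
  nonempty (otherwise \<^const>\<open>pmf_of_set\<close> is unspecified).\<close>

definition uniformly_distributed_on :: "'a measure \<Rightarrow> ('a \<Rightarrow> real) \<Rightarrow> real set \<Rightarrow> bool" where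
  "uniformly_distributed_on M X S \<longleftrightarrow>
     X \<in> borel_measurable M \<and>
     distr M borel X = distr (measure_pmf (pmf_of_set S)) borel (\<lambda>x. x)"

definition identically_distributed :: "'a measure \<Rightarrow> ('a \<Rightarrow> real) \<Rightarrow> ('a \<Rightarrow> real) \<Rightarrow> bool" where
  "identically_distributed M X Y \<longleftrightarrow>
     X \<in> borel_measurable M \<and> Y \<in> borel_measurable M \<and> distr M borel X = distr M borel Y"

text \<open>Mutual (not just pairwise) independence.\<close>

definition independent3 ::
    "'a measure \<Rightarrow> ('a \<Rightarrow> real) \<Rightarrow> ('a \<Rightarrow> real) \<Rightarrow> ('a \<Rightarrow> real) \<Rightarrow> bool" where
  "independent3 M X Y Z \<longleftrightarrow>
     prob_space.indep_vars M (\<lambda>_. borel) (\<lambda>i. [X, Y, Z] ! i) {..<3::nat}"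

end

theory Submission
  imports Defs
begin

text \<open>For powers of two, \<open>2 ^ i < (2 ^ j + 2 ^ k) / 2\<close> just says \<open>i < max j k\<close>, so (1) is the
  count \<open>\<Sum>j<m. \<Sum>k<m. max j k\<close>. For (2), the largest of three reals is never below the mean of
  the other two, so at most two of the three cyclic versions of the event occur at a time, and none
  does when \<open>A = B = C\<close>; the three versions are equally likely.\<close>

section \<open>Independent triples: reindexing, joint law, point probabilities\<close>

lemma (in prob_space) indep_sets_reindex:
  assumes "inj_on s I" "indep_sets F (s ` I)"
  shows "indep_sets (\<lambda>i. F (s i)) I"
proof (rule indep_setsI)
  show "F (s i) \<subseteq> events" if "i \<in> I" for i
    using assms(2) that by (auto simp: indep_sets_def)
next
  fix A J assume J: "J \<noteq> {}" "J \<subseteq> I" "finite J" and A: "\<forall>j\<in>J. A j \<in> F (s j)"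
  \<comment> \<open>\<open>B\<close> carries the chosen events over to the image of
    \<open>J\<close>. Since \<open>s\<close> is injective on \<open>I\<close>,
    \<open>inv_into\<close> recovers \<open>j\<close> from \<open>s j\<close>, and the product over
    the image has no collapsed factors.\<close>
  define B where "B = (\<lambda>i. A (inv_into I s i))"
  have B: "B (s j) = A j" if "j \<in> J" for j
    using that J assms(1) by (auto simp: B_def)
  have "prob (\<Inter>i\<in>s ` J. B i) = (\<Prod>i\<in>s ` J. prob (B i))"
    using J A B assms(2) by (intro indep_setsD) auto
  also have "\<dots> = (\<Prod>j\<in>J. prob (A j))"
    using J assms(1) B by (subst prod.reindex) (auto intro: inj_on_subset)
  finally show "prob (\<Inter>j\<in>J. A j) = (\<Prod>j\<in>J. prob (A j))"
    using B by simp
qed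

lemma (in prob_space) indep_vars_reindex:
  assumes "inj_on s I" "indep_vars N X (s ` I)"
  shows "indep_vars (\<lambda>i. N (s i)) (\<lambda>i. X (s i)) I"
  using assms indep_sets_reindex[OF assms(1)] unfolding indep_vars_def2 by auto

text \<open>The shift \<open>i + 1\<close> modulo 3 permutes the three indices, and mutual
  independence survives any injective reindexing. This makes the three cyclic versions of the event
  comparable.\<close>

lemma independent3_rotate:
  assumes "prob_space M" "independent3 M X Y Z"
  shows "independent3 M Y Z X"
proof -
  interpret prob_space M by fact
  let ?s = "\<lambda>i::nat. (i + 1) mod 3"
  have three: "{..<3} = {0, 1, 2::nat}" by auto
  have inj: "inj_on ?s {..<3}" and img: "?s ` {..<3} = {..<3}"
    unfolding three by auto
  have "indep_vars (\<lambda>_. borel) (\<lambda>i. [X, Y, Z] ! i) (?s ` {..<3})"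
    using assms(2) unfolding independent3_def img .
  from indep_vars_reindex[OF inj this]
  have "indep_vars (\<lambda>_. borel) (\<lambda>i. [X, Y, Z] ! ?s i) {..<3}"
    by simp
  also have "indep_vars (\<lambda>_. borel) (\<lambda>i. [X, Y, Z] ! ?s i) {..<3} =
      indep_vars (\<lambda>_. borel) (\<lambda>i. [Y, Z, X] ! i) {..<3}"
    by (rule indep_vars_cong) (auto simp: three)
  finally show ?thesis
    unfolding independent3_def .
qed

lemma independent3_measurable:
  assumes "prob_space M" "independent3 M X Y Z"
  shows "X \<in> borel_measurable M" "Y \<in> borel_measurable M" "Z \<in> borel_measurable M"
proof -
  interpret prob_space M by fact
  have "\<And>i. i < 3 \<Longrightarrow> [X, Y, Z] ! i \<in> borel_measurable M"
    using assms(2) unfolding independent3_def indep_vars_def by auto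
  from this[of 0] this[of 1] this[of 2] show "X \<in> borel_measurable M" "Y \<in> borel_measurable M" "Z \<in> borel_measurable M"
    by auto
qed

text \<open>Independence makes the joint law the product of the marginal laws, so triples with
  matching marginals have the same joint law and give every measurable event the same probability.
  The condition \<open>Q\<close> is read on functions over \<open>{..<3}\<close> because that is
  where the product measure lives.\<close>

lemma independent3_prob_eq:
  assumes "prob_space M" "independent3 M X Y Z" "independent3 M U V W"
    and "distr M borel X = distr M borel U" "distr M borel Y = distr M borel V"
    and "distr M borel Z = distr M borel W"
    and Q: "{f \<in> space (\<Pi>\<^sub>M i\<in>{..<3::nat}. borel). Q (f 0) (f 1) (f 2)} \<in> sets (\<Pi>\<^sub>M i\<in>{..<3::nat}. borel)"
  shows "\<P>(\<omega> in M. Q (X \<omega>) (Y \<omega>) (Z \<omega>)) = \<P>(\<omega> in M. Q (U \<omega>) (V \<omega>) (W \<omega>))"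
proof -
  interpret prob_space M by fact
  let ?P = "\<Pi>\<^sub>M i\<in>{..<3::nat}. (borel :: real measure)"
  let ?S = "{f \<in> space ?P. Q (f 0) (f 1) (f 2)}"
  let ?t = "\<lambda>X Y Z \<omega>. \<lambda>i\<in>{..<3::nat}. ([X, Y, Z] ! i) \<omega> :: real"
  have joint: "distr M ?P (?t X Y Z) = (\<Pi>\<^sub>M i\<in>{..<3}. distr M borel ([X, Y, Z] ! i))"
    and meas: "?t X Y Z \<in> measurable M ?P"
    if "independent3 M X Y Z" for X Y Z
  proof -
    have rv: "[X, Y, Z] ! i \<in> borel_measurable M" if "i \<in> {..<3}" for i
      using \<open>independent3 M X Y Z\<close> that unfolding independent3_def indep_vars_def by auto
    show "distr M ?P (?t X Y Z) = (\<Pi>\<^sub>M i\<in>{..<3}. distr M borel ([X, Y, Z] ! i))"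
      using that rv unfolding independent3_def
      by (subst (asm) indep_vars_iff_distr_eq_PiM') (auto simp: lessThan_empty_iff)
    show "?t X Y Z \<in> measurable M ?P"
      by (intro measurable_restrict rv)
  qed
  have law: "\<P>(\<omega> in M. Q (X \<omega>) (Y \<omega>) (Z \<omega>)) = measure (\<Pi>\<^sub>M i\<in>{..<3}. distr M borel ([X, Y, Z] ! i)) ?S"
    if "independent3 M X Y Z" for X Y Z
    unfolding joint[OF that, symmetric] measure_distr[OF meas[OF that] Q]
    by (intro arg_cong[where f = "measure M"]) (auto simp: space_PiM)
  have "distr M borel ([X, Y, Z] ! i) = distr M borel ([U, V, W] ! i)" if "i \<in> {..<3}" for i
  proof -
    have "i = 0 \<or> i = 1 \<or> i = 2" using that by auto
    then show ?thesis using assms(4-6) by auto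
  qed
  then have "(\<Pi>\<^sub>M i\<in>{..<3}. distr M borel ([X, Y, Z] ! i)) = (\<Pi>\<^sub>M i\<in>{..<3}. distr M borel ([U, V, W] ! i))"
    by (intro PiM_cong) auto
  then show ?thesis
    using law assms(2,3) by simp
qed

lemma independent3_prob_point:
  assumes "prob_space M" "independent3 M X Y Z"
  shows "\<P>(\<omega> in M. X \<omega> = x \<and> Y \<omega> = y \<and> Z \<omega> = z) =
    \<P>(\<omega> in M. X \<omega> = x) * \<P>(\<omega> in M. Y \<omega> = y) * \<P>(\<omega> in M. Z \<omega> = z)"
proof -
  interpret prob_space M by fact
  have eq: "{..<3::nat} = {0, 1, 2}" by auto
  have "prob (\<Inter>j\<in>{..<3}. ([X, Y, Z] ! j) -` {[x, y, z] ! j} \<inter> space M) =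
      (\<Prod>j\<in>{..<3}. prob (([X, Y, Z] ! j) -` {[x, y, z] ! j} \<inter> space M))"
    using assms(2) unfolding independent3_def by (rule indep_varsD) (auto simp: lessThan_empty_iff)
  moreover have "(\<Inter>j\<in>{..<3}. ([X, Y, Z] ! j) -` {[x, y, z] ! j} \<inter> space M) =
      {\<omega> \<in> space M. X \<omega> = x \<and> Y \<omega> = y \<and> Z \<omega> = z}"
    by (auto simp: eq)
  moreover have "(\<Prod>j\<in>{..<3}. prob (([X, Y, Z] ! j) -` {[x, y, z] ! j} \<inter> space M)) =
    \<P>(\<omega> in M. X \<omega> = x) * \<P>(\<omega> in M. Y \<omega> = y) * \<P>(\<omega> in M. Z \<omega> = z)"
    by (auto simp: eq vimage_def Int_def conj_commute)
  ultimately show ?thesis by simp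
qed

section \<open>Uniform laws on finite sets\<close>

lemma uniformly_distributed_on_prob:
  assumes "uniformly_distributed_on M X S" "finite S" "x \<in> S"
  shows "\<P>(\<omega> in M. X \<omega> = x) = 1 / card S"
proof -
  have X: "X \<in> borel_measurable M"
    and D: "distr M borel X = distr (measure_pmf (pmf_of_set S)) borel (\<lambda>x. x)"
    using assms(1) by (auto simp: uniformly_distributed_on_def)
  have "\<P>(\<omega> in M. X \<omega> = x) = measure (distr M borel X) {x}"
    using X by (subst measure_distr) (auto intro!: arg_cong[where f = "measure M"])
  also have "\<dots> = pmf (pmf_of_set S) x"
    unfolding D by (subst measure_distr) (auto simp: pmf.rep_eq)
  finally show ?thesis
    using assms(2,3) by (subst (asm) pmf_of_set) auto
qed

text \<open>Only the law of \<open>X\<close> is prescribed, so \<open>X\<close> may leave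
  \<open>S\<close> on a null set. This bound on its values lets an event be cut down to finitely
  many value combinations.\<close>

lemma uniformly_distributed_on_AE:
  assumes "uniformly_distributed_on M X S" "finite S" "S \<noteq> {}"
  shows "AE \<omega> in M. X \<omega> \<in> S"
proof -
  have X: "X \<in> borel_measurable M"
    and D: "distr M borel X = distr (measure_pmf (pmf_of_set S)) borel (\<lambda>x. x)"
    using assms(1) by (auto simp: uniformly_distributed_on_def)
  have S: "S \<in> sets borel"
    using assms(2) by (simp add: borel_closed finite_imp_closed)
  have "AE x in distr M borel X. x \<in> S"
    unfolding D using S assms(2,3) by (subst AE_distr_iff) (auto simp: AE_measure_pmf_iff)
  then show ?thesis
    using X S by (subst (asm) AE_distr_iff) auto
qed

section \<open>Counting exponents for powers of two\<close>

lemma power2_less_mean_iff: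
  "(2::real) ^ i < (2 ^ j + 2 ^ k) / 2 \<longleftrightarrow> i < max j k"
proof -
  have mean: "x \<le> y \<Longrightarrow> (x + y) / 2 \<le> y" for x y :: real
    by simp
  \<comment> \<open>By symmetry the larger exponent may be taken to be \<open>k\<close>. If
    \<open>i < k\<close>, doubling \<open>2 ^ i\<close> gives at most \<open>2 ^ k\<close>, and the
    positive term \<open>2 ^ j\<close> makes the inequality strict; conversely, the mean never
    exceeds \<open>2 ^ k\<close>.\<close>
  have *: "(2::real) ^ i < (2 ^ j + 2 ^ k) / 2 \<longleftrightarrow> i < k" if "j \<le> k" for j k
  proof
    assume "i < k"
    then have "(2::real) ^ Suc i \<le> 2 ^ k"
      by (intro power_increasing) auto
    also have "(2::real) ^ k < 2 ^ j + 2 ^ k" by simp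
    finally show "(2::real) ^ i < (2 ^ j + 2 ^ k) / 2" by simp
  next
    assume "(2::real) ^ i < (2 ^ j + 2 ^ k) / 2"
    also have "(2 ^ j + 2 ^ k) / 2 \<le> (2::real) ^ k"
      by (rule mean) (use that in \<open>simp add: power_increasing\<close>)
    finally have "(2::real) ^ i < 2 ^ k" .
    then show "i < k" by simp
  qed
  show ?thesis
    using *[of j k] *[of k j] by (cases "j \<le> k") (auto simp: max_def add.commute)
qed

text \<open>Enlarging the square from \<open>m\<close> to \<open>Suc m\<close> adds a row and a
  column, each with \<open>m\<close> entries equal to \<open>m\<close>, and the corner entry
  \<open>m\<close>. The factor 6 keeps the closed form free of division.\<close>

lemma sum_max:
  "6 * (\<Sum>j<m. \<Sum>k<m. real (max j k)) = real m * (real m - 1) * (4 * real m + 1)"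
proof (induction m)
  case (Suc m)
  have *: "(\<Sum>k<m. real (max m k)) = real m * real m" "(\<Sum>k<m. real (max k m)) = real m * real m"
    by (simp_all add: max_def)
  have "(\<Sum>j<Suc m. \<Sum>k<Suc m. real (max j k)) =
      (\<Sum>j<m. \<Sum>k<m. real (max j k)) + 2 * (real m * real m) + real m"
    by (simp add: sum.distrib * distrib_right del: of_nat_max)
  then show ?case
    using Suc by (simp add: algebra_simps del: of_nat_max)
qed simp

text \<open>Up to a null set the event is a disjoint union of single value triples, each of
  probability \<open>1 / m ^ 3\<close>, so the probability is a count divided by
  \<open>m ^ 3\<close>.\<close>

lemma prob_uniform_powers:
  assumes "prob_space M" "independent3 M A B C" "m \<ge> 1"
    and U: "\<And>X. X \<in> {A, B, C} \<Longrightarrow> uniformly_distributed_on M X ((\<lambda>k. 2 ^ k) ` {..<m})"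
  shows "\<P>(\<omega> in M. A \<omega> < (B \<omega> + C \<omega>) / 2) = 2 / 3 - 1 / (2 * real m) - 1 / (6 * (real m)\<^sup>2)"
proof -
  interpret prob_space M by fact
  note [measurable] = independent3_measurable[OF assms(1,2)]
  let ?S = "(\<lambda>k. (2::real) ^ k) ` {..<m}"
  \<comment> \<open>The exponent \<open>i\<close> of \<open>A\<close> is nested under the pair
    \<open>(j, k)\<close>, so that \<open>card T\<close> is directly the double sum of
    \<open>max j k\<close>. The bound \<open>i < m\<close> is implied by
    \<open>i < max j k\<close>.\<close>
  define T where "T = (SIGMA p:{..<m} \<times> {..<m}. {..<max (fst p) (snd p)})"
  define E where "E = (\<lambda>((j, k), i). {\<omega> \<in> space M. A \<omega> = 2 ^ i \<and> B \<omega> = 2 ^ j \<and> C \<omega> = 2 ^ k})"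
  have fin: "finite T" by (auto simp: T_def)
  have cardS: "card ?S = m"
    by (subst card_image) (auto simp: inj_on_def)
  have AE_S: "AE \<omega> in M. X \<omega> \<in> ?S" if "X \<in> {A, B, C}" for X
    using that assms(3) by (intro uniformly_distributed_on_AE U) (auto simp: lessThan_empty_iff)
  have pt: "\<P>(\<omega> in M. X \<omega> = 2 ^ i) = 1 / real m" if "X \<in> {A, B, C}" "i < m" for X i
    using uniformly_distributed_on_prob[OF U[OF that(1)], of "2 ^ i"] that(2) cardS by auto
  have probE: "prob (E t) = 1 / real m ^ 3" if "t \<in> T" for t
  proof -
    obtain j k i where t: "t = ((j, k), i)" by (metis surj_pair)
    have lt: "i < m" "j < m" "k < m" using that by (auto simp: T_def t)
    show ?thesis
      unfolding E_def t prod.case independent3_prob_point[OF assms(1,2)]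
      using lt by (simp add: pt power3_eq_cube)
  qed
  have union: "(\<Union>t\<in>T. E t) = {\<omega> \<in> space M. A \<omega> < (B \<omega> + C \<omega>) / 2 \<and> A \<omega> \<in> ?S \<and> B \<omega> \<in> ?S \<and> C \<omega> \<in> ?S}"
    (is "_ = ?R")
  proof (intro equalityI subsetI)
    fix \<omega> assume "\<omega> \<in> (\<Union>t\<in>T. E t)"
    then show "\<omega> \<in> ?R"
      by (auto simp only: T_def E_def power2_less_mean_iff) auto
  next
    fix \<omega> assume "\<omega> \<in> ?R"
    then obtain i j k where "A \<omega> = 2 ^ i" "B \<omega> = 2 ^ j" "C \<omega> = 2 ^ k" "i < m" "j < m" "k < m"
      "\<omega> \<in> space M" "(2::real) ^ i < (2 ^ j + 2 ^ k) / 2" by auto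
    then have "((j, k), i) \<in> T" "\<omega> \<in> E ((j, k), i)"
      by (auto simp only: power2_less_mean_iff T_def E_def) auto
    then show "\<omega> \<in> (\<Union>t\<in>T. E t)" by blast
  qed
  have E_sets: "E ` T \<subseteq> events"
    by (auto simp: E_def)
  have "\<P>(\<omega> in M. A \<omega> < (B \<omega> + C \<omega>) / 2) = prob (\<Union>t\<in>T. E t)"
  proof (rule finite_measure_eq_AE)
    show "AE \<omega> in M. \<omega> \<in> {\<omega> \<in> space M. A \<omega> < (B \<omega> + C \<omega>) / 2} \<longleftrightarrow> \<omega> \<in> (\<Union>t\<in>T. E t)"
      unfolding union using AE_S[of A] AE_S[of B] AE_S[of C] by auto
    show "(\<Union>t\<in>T. E t) \<in> events"
      using E_sets fin by auto
  qed measurable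
  also have "\<dots> = (\<Sum>t\<in>T. prob (E t))"
    \<comment> \<open>The events are disjoint because a power of 2 determines its exponent.\<close>
    using fin E_sets by (rule finite_measure_finite_Union) (auto simp: disjoint_family_on_def E_def)
  also have "\<dots> = real (card T) / real m ^ 3"
    by (simp add: probE)
  also have "real (card T) = (\<Sum>j<m. \<Sum>k<m. real (max j k))"
    by (simp add: T_def sum.cartesian_product case_prod_beta del: of_nat_max)
  also have "\<dots> = real m * (real m - 1) * (4 * real m + 1) / 6"
    using sum_max[of m] by simp
  also have "\<dots> / real m ^ 3 = 2 / 3 - 1 / (2 * real m) - 1 / (6 * (real m)\<^sup>2)"
    using assms(3) by (simp add: field_simps power2_eq_square power3_eq_cube)
  finally show ?thesis .
qed

section \<open>The bound 2/3 and its strictness\<close>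

text \<open>This quantitative form yields both claims of (2): dropping the subtracted term gives the
  bound, and at an atom \<open>a\<close> that term is positive. It measures the loss on the event
  that all three variables equal \<open>a\<close>, whose probability is a cube by
  independence.\<close>

lemma prob_less_mean:
  assumes "prob_space M" "independent3 M A B C"
    and AB: "identically_distributed M A B" and AC: "identically_distributed M A C"
  shows "\<P>(\<omega> in M. A \<omega> < (B \<omega> + C \<omega>) / 2) \<le> 2 / 3 - 2 / 3 * \<P>(\<omega> in M. A \<omega> = a) ^ 3"
proof -
  interpret prob_space M by fact
  note [measurable] = independent3_measurable[OF assms(1,2)]
  let ?L = "\<lambda>x y z::real. x < (y + z) / 2"
  define E1 where "E1 = {\<omega> \<in> space M. ?L (A \<omega>) (B \<omega>) (C \<omega>)}"
  define E2 where "E2 = {\<omega> \<in> space M. ?L (B \<omega>) (C \<omega>) (A \<omega>)}"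
  define E3 where "E3 = {\<omega> \<in> space M. ?L (C \<omega>) (A \<omega>) (B \<omega>)}"
  define D where "D = {\<omega> \<in> space M. A \<omega> = a \<and> B \<omega> = a \<and> C \<omega> = a}"
  have [measurable]: "E1 \<in> events" "E2 \<in> events" "E3 \<in> events" "D \<in> events"
    unfolding E1_def E2_def E3_def D_def by measurable
  have int: "integrable M (indicat_real E)" if "E \<in> events" for E
    using that by (simp add: less_top[symmetric])
  have law: "distr M borel B = distr M borel A" "distr M borel C = distr M borel A"
    using AB AC by (simp_all add: identically_distributed_def)
  have Q: "{f \<in> space (\<Pi>\<^sub>M i\<in>{..<3::nat}. borel). ?L (f 0) (f 1) (f 2)} \<in> sets (\<Pi>\<^sub>M i\<in>{..<3::nat}. borel)"
    by measurable
  note i2 = independent3_rotate[OF assms(1,2)]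
  note i3 = independent3_rotate[OF assms(1) i2]
  \<comment> \<open>\<open>E2\<close> is the event \<open>E1\<close> written for the rotated triple
    \<open>B, C, A\<close>, which has the same joint law; \<open>E3\<close> is the next
    rotation.\<close>
  have e2: "prob E2 = prob E1"
    unfolding E1_def E2_def
    by (rule independent3_prob_eq[OF assms(1) i2 assms(2) _ _ _ Q]) (simp_all add: law)
  have e3: "prob E3 = prob E1"
    unfolding E1_def E3_def
    by (rule independent3_prob_eq[OF assms(1) i3 assms(2) _ _ _ Q]) (simp_all add: law)
  have point: "\<P>(\<omega> in M. X \<omega> = a) = measure (distr M borel X) {a}" if "X \<in> borel_measurable M" for X
    using that by (subst measure_distr) (auto intro!: arg_cong[where f = prob])
  have D: "prob D = \<P>(\<omega> in M. A \<omega> = a) ^ 3"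
    unfolding D_def independent3_prob_point[OF assms(1,2)]
    by (simp add: point law power3_eq_cube)
  have "3 * prob E1 + 2 * prob D = prob E1 + prob E2 + prob E3 + 2 * prob D"
    using e2 e3 by simp
  also have "\<dots> = (\<integral>\<omega>. indicator E1 \<omega> + indicator E2 \<omega> + indicator E3 \<omega> + 2 * indicator D \<omega> \<partial>M)"
    by (simp add: int)
  also have "\<dots> \<le> (\<integral>\<omega>. 2 \<partial>M)"
  proof (rule integral_mono)
    \<comment> \<open>All three inequalities together would add up to
      \<open>A + B + C < A + B + C\<close>, so at most two indicators are 1. On \<open>D\<close> all
      three vanish, which leaves room for exactly the weight 2.\<close>
    show "indicat_real E1 \<omega> + indicat_real E2 \<omega> + indicat_real E3 \<omega> + 2 * indicat_real D \<omega> \<le> 2" for \<omega>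
      by (auto simp: indicator_def E1_def E2_def E3_def D_def)
  qed (simp_all add: int)
  also have "\<dots> = 2" by (simp add: prob_space)
  finally show ?thesis using D by (simp add: E1_def)
qed

theorem theorem1p5:
  fixes M :: "'a measure" and A B C :: "'a \<Rightarrow> real"
  assumes "prob_space M"
    and "independent3 M A B C"
  shows
    "(\<forall>m::nat. m \<ge> 1 \<longrightarrow>
        (\<forall>X\<in>{A, B, C}. uniformly_distributed_on M X ((\<lambda>k. 2 ^ k) ` {..<m})) \<longrightarrow>
        \<P>(\<omega> in M. A \<omega> < (B \<omega> + C \<omega>) / 2) = 2 / 3 - 1 / (2 * real m) - 1 / (6 * (real m)\<^sup>2))
     \<and>
     (identically_distributed M A B \<and> identically_distributed M A C \<and>
        (\<forall>X\<in>{A, B, C}. AE \<omega> in M. X \<omega> \<ge> 0) \<longrightarrow>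
        \<P>(\<omega> in M. A \<omega> < (B \<omega> + C \<omega>) / 2) \<le> 2 / 3 \<and>
        ((\<exists>a\<ge>0. \<P>(\<omega> in M. A \<omega> = a) > 0) \<longrightarrow>
           \<P>(\<omega> in M. A \<omega> < (B \<omega> + C \<omega>) / 2) < 2 / 3))"
proof -
  have "\<P>(\<omega> in M. A \<omega> < (B \<omega> + C \<omega>) / 2) \<le> 2 / 3 \<and>
      ((\<exists>a\<ge>0. \<P>(\<omega> in M. A \<omega> = a) > 0) \<longrightarrow> \<P>(\<omega> in M. A \<omega> < (B \<omega> + C \<omega>) / 2) < 2 / 3)"
    if "identically_distributed M A B" "identically_distributed M A C"
  proof -
    note le = prob_less_mean[OF assms that]
    \<comment> \<open>The point 0 is an arbitrary choice: at any point the subtracted cube is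
      nonnegative.\<close>
    have "0 \<le> \<P>(\<omega> in M. A \<omega> = 0) ^ 3" by simp
    then have "\<P>(\<omega> in M. A \<omega> < (B \<omega> + C \<omega>) / 2) \<le> 2 / 3"
      using le[of 0] by linarith
    moreover have "\<P>(\<omega> in M. A \<omega> < (B \<omega> + C \<omega>) / 2) < 2 / 3" if "\<P>(\<omega> in M. A \<omega> = a) > 0" for a
      using le[of a] zero_less_power[OF that, of 3] by linarith
    ultimately show ?thesis by blast
  qed
  then show ?thesis
    using prob_uniform_powers[OF assms] by blast
qed

end
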